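(* Let $H_0,\dots,H_4$ be harmonic homologies of the real projective plane, with axes $L_0,\dots,L_4$ and centres $O_0,\dots,O_4$, such that $H_4H_3H_2H_1H_0=-I$, the axes $L_0,\dots,L_4$ are the lines supporting the five sides of a convex pentagon, the centres are pairwise distinct, and no four of the centres are collinear. Then the five mirrors preserve a nondegenerate conic: there is a nondegenerate real symmetric $3\times3$ matrix $Q$ with $H_i^\top QH_i=Q$ for $i=0,\dots,4$. Thus the billiard is one of constant curvature in the Cayley–Klein sense.
   Context: For a nonzero row vector (covector) $L$ and a nonzero column vector $O$ in $\mathbb{R}^3$ with $LO\ne0$, the harmonic homology with axis $L$ and centre $O$ is $H=I-2\,OL/(LO)$. The plane $\mathbb{R}^2$ is regarded as the affine chart $\{(x,y,1)\}$ of $\mathbb{RP}^2$; the billiard is the projective billiard in the convex pentagon for which the transversal lines on side $i$ form the pencil through $O_i$, so that reflection in side $i$ is $H_i$. "Constant curvature in the Cayley–Klein sense" means that the reflections $H_i$ belong to the orthogonal group of a nondegenerate quadratic form $Q$ (of either definite or indefinite signature, the signature deciding which geometry; only the definite case is a metric billiard on the whole domain). *)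

theory Defs
  imports "HOL-Analysis.Analysis"
begin

text \<open>
  Points and lines of the real projective plane are given by nonzero vectors and covectors of
  \<open>\<real>\<^sup>3\<close>, both of type \<^typ>\<open>real^3\<close>; the pairing of a covector \<open>l\<close> with a vector \<open>v\<close> is
  \<open>l \<bullet> v\<close>.  The five sides are indexed by the type \<^typ>\<open>5\<close>, whose arithmetic is modulo 5, so
  that \<open>i + 1\<close> is the cyclic successor.
\<close>

text \<open>
  The type constraints make the matrix product a column times a row: the inner index type of
  \<^const>\<open>columnvector\<close> and \<^const>\<open>rowvector\<close> is otherwise arbitrary, and its size would enter
  as a factor.
\<close>

definition harmonic_homology :: "real^3 \<Rightarrow> real^3 \<Rightarrow> real^3^3" where
  "harmonic_homology l v =
     mat 1 - (2 / (l \<bullet> v)) *\<^sub>R ((columnvector v :: real^1^3) ** (rowvector l :: real^3^1))"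

definition is_harmonic_homology :: "real^3^3 \<Rightarrow> real^3 \<Rightarrow> real^3 \<Rightarrow> bool" where
  "is_harmonic_homology A l v \<longleftrightarrow>
     l \<noteq> 0 \<and> v \<noteq> 0 \<and> l \<bullet> v \<noteq> 0 \<and> A = harmonic_homology l v"

definition same_proj_point :: "real^3 \<Rightarrow> real^3 \<Rightarrow> bool" where
  "same_proj_point u v \<longleftrightarrow> (\<exists>c. c \<noteq> 0 \<and> u = c *\<^sub>R v)"

definition proj_collinear :: "(real^3) set \<Rightarrow> bool" where
  "proj_collinear X \<longleftrightarrow> (\<exists>l. l \<noteq> 0 \<and> (\<forall>v\<in>X. l \<bullet> v = 0))"

definition affine_chart :: "real^2 \<Rightarrow> real^3" where
  "affine_chart x = vector [x $ 1, x $ 2, 1]"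

definition affine_part :: "real^3 \<Rightarrow> (real^2) set" where
  "affine_part l = {x. l \<bullet> affine_chart x = 0}"

text \<open>
  \<open>P\<close> lists the vertices of a convex pentagon in cyclic order.  Angles equal to \<open>\<pi>\<close> are excluded
  because every \<open>P i\<close> is required to be an extreme point; star pentagons are excluded because
  the sides are required to be edges of the convex hull.
\<close>

definition convex_pentagon :: "(5 \<Rightarrow> real^2) \<Rightarrow> bool" where
  "convex_pentagon P \<longleftrightarrow>
     inj P \<and>
     (\<forall>i. P i extreme_point_of (convex hull (range P))) \<and>
     (\<forall>i. closed_segment (P i) (P (i + 1)) edge_of (convex hull (range P)))"

definition side_line :: "(5 \<Rightarrow> real^2) \<Rightarrow> 5 \<Rightarrow> (real^2) set" where
  "side_line P i = affine hull {P i, P (i + 1)}"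

definition nondegenerate_symmetric :: "real^3^3 \<Rightarrow> bool" where
  "nondegenerate_symmetric Q \<longleftrightarrow> transpose Q = Q \<and> det Q \<noteq> 0"

text \<open>The orthogonal group of the quadratic form \<open>x \<mapsto> x\<^sup>T Q x\<close>, of any signature.\<close>

definition orthogonal_group_of :: "real^3^3 \<Rightarrow> (real^3^3) set" where
  "orthogonal_group_of Q =
     {A. invertible A \<and> (\<forall>x. (A *v x) \<bullet> (Q *v (A *v x)) = x \<bullet> (Q *v x))}"

text \<open>
  Constant curvature in the Cayley--Klein sense, for the projective billiard whose reflection in
  the side supported by the axis of \<open>H i\<close> is \<open>H i\<close>.
\<close>

definition cayley_klein_constant_curvature :: "(5 \<Rightarrow> real^3^3) \<Rightarrow> bool" where
  "cayley_klein_constant_curvature H \<longleftrightarrow>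
     (\<exists>Q. nondegenerate_symmetric Q \<and> (\<forall>i. H i \<in> orthogonal_group_of Q))"

end

theory Submission
  imports Defs
begin

text \<open>
  Scale the axes so that each covector \<open>l\<^sub>i\<close> takes the value 1 on its centre \<open>v\<^sub>i\<close>, and put
  \<open>a\<^sub>i\<^sub>j = l\<^sub>i v\<^sub>j\<close>.  A symmetric \<open>Q\<close> is invariant under all five mirrors as soon as the polarity of
  \<open>Q\<close> sends each centre to its axis, \<open>Q v\<^sub>i = \<mu>\<^sub>i l\<^sub>i\<close>, and such a \<open>Q\<close> exists exactly when the
  matrix \<open>a\<close> is symmetrizable: \<open>\<mu>\<^sub>i a\<^sub>i\<^sub>j = \<mu>\<^sub>j a\<^sub>j\<^sub>i\<close> with nonzero \<open>\<mu>\<^sub>i\<close>.  Symmetrizability means that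
  zeros occur in symmetric positions and that the product of the entries around any closed walk
  is the same in both directions.

  The relation \<open>H\<^sub>4 H\<^sub>3 H\<^sub>2 H\<^sub>1 H\<^sub>0 = -I\<close> gives such identities through traces.  The mirrors being
  involutions, \<open>H\<^sub>4 H\<^sub>3 H\<^sub>2 = -H\<^sub>0 H\<^sub>1\<close> and \<open>H\<^sub>2 H\<^sub>3 H\<^sub>4 = -H\<^sub>1 H\<^sub>0\<close>; the right-hand sides have equal
  traces, and expanding the traces of the left-hand sides yields the identity for the triangle
  \<open>4, 3, 2\<close>.  The hypothesis on the product survives cyclic rotation and the Hurwitz move
  \<open>(A, B) \<mapsto> (B, B A B)\<close>, so the identity reaches all triangles, and applied to conjugated
  mirrors it gives all quadrilaterals as well (\<open>closed_all_triangles\<close>, \<open>closed_all_quads\<close>).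

  The position of the axes and centres does the rest.  Since any three sides of a pentagon
  include two adjacent ones, no three axes are concurrent.  Hence a column of \<open>a\<close> has at most
  two zeros, and together with the condition on the centres this excludes \<open>a\<^sub>u\<^sub>v = 0 \<noteq> a\<^sub>v\<^sub>u\<close>
  (\<open>zero_symmetric\<close>).  The cycles in the graph of nonzero entries are then generated by
  triangles and quadrilaterals, unless the graph is a single 5-cycle; in that case each axis
  passes through two centres, as in a self-polar pentagon, and the 5-cycle identity follows from
  the rank of \<open>a\<close> being at most 3 (\<open>five_cycle\<close>).
\<close>

section \<open>Mirrors as pairs of a covector and a vector\<close>

type_synonym flag = "(real^3) \<times> (real^3)"

definition pairing :: "flag \<Rightarrow> flag \<Rightarrow> real" where
  "pairing p q = fst p \<bullet> snd q"

definition mirror :: "flag \<Rightarrow> real^3^3" where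
  "mirror p = harmonic_homology (fst p) (snd p)"

lemma harmonic_homology_mult_vec:
  "harmonic_homology l v *v x = x - (2 * (l \<bullet> x) / (l \<bullet> v)) *\<^sub>R v"
  unfolding harmonic_homology_def
  apply (simp add: vec_eq_iff matrix_vector_mult_def matrix_matrix_mult_def
      columnvector_def rowvector_def mat_def sum_3 forall_3 inner_vec_def)
  by (simp add: algebra_simps add_divide_distrib)

lemma mirror_mult_vec:
  assumes "pairing p p = 1"
  shows "mirror p *v x = x - (2 * (fst p \<bullet> x)) *\<^sub>R snd p"
  using assms by (simp add: mirror_def harmonic_homology_mult_vec pairing_def)

text \<open>
  A mirror differs from the identity by a matrix of rank one, so each factor of a product of
  mirrors can be peeled off its trace at the cost of one pairing.  All trace computations go
  through this.
\<close>

lemma trace_mult_mirror: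
  assumes "pairing p p = 1"
  shows "trace (A ** mirror p) = trace A - 2 * (fst p \<bullet> (A *v snd p))"
  using assms
  apply (simp add: mirror_def harmonic_homology_def pairing_def trace_def
      matrix_matrix_mult_def columnvector_def rowvector_def mat_def sum_3 inner_vec_def matrix_vector_mult_def)
  by (simp add: algebra_simps)

lemma mirror_involution:
  assumes "pairing p p = 1"
  shows "mirror p ** mirror p = mat 1"
  using assms
  by (simp add: matrix_eq mirror_mult_vec pairing_def inner_simps vec_eq_iff
      flip: matrix_vector_mul_assoc)

text \<open>
  The image of the flag \<open>q\<close> under the mirror in \<open>p\<close>, covectors being moved contragrediently; see
  \<open>mirror_reflected\<close>.
\<close>

definition reflected :: "flag \<Rightarrow> flag \<Rightarrow> flag" where
  "reflected p q = (fst q - (2 * pairing q p) *\<^sub>R fst p, snd q - (2 * pairing p q) *\<^sub>R snd p)"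

lemma pairing_reflected:
  "pairing r (reflected p q) = pairing r q - 2 * pairing r p * pairing p q"
  "pairing (reflected p q) r = pairing q r - 2 * pairing q p * pairing p r"
  by (simp_all add: pairing_def reflected_def inner_simps)

lemma pairing_reflected_self:
  assumes "pairing p p = 1" "pairing q q = 1"
  shows "pairing (reflected p q) (reflected p q) = 1"
  using assms by (simp add: pairing_reflected algebra_simps)

lemma mirror_reflected:
  assumes "pairing p p = 1" "pairing q q = 1"
  shows "mirror (reflected p q) = mirror p ** mirror q ** mirror p"
proof -
  have 1: "pairing (reflected p q) (reflected p q) = 1" using assms by (rule pairing_reflected_self)
  have 2: "fst p \<bullet> snd p = 1" "fst q \<bullet> snd q = 1" using assms by (simp_all add: pairing_def)
  show ?thesis
    unfolding matrix_eq matrix_vector_mul_assoc[symmetric] mirror_mult_vec[OF 1]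
      mirror_mult_vec[OF assms(1)] mirror_mult_vec[OF assms(2)]
    by (simp add: reflected_def pairing_def inner_simps vec_eq_iff 2) (simp add: algebra_simps)
qed

section \<open>Trace identities for five mirrors with product minus the identity\<close>

definition closed_tuple :: "flag \<Rightarrow> flag \<Rightarrow> flag \<Rightarrow> flag \<Rightarrow> flag \<Rightarrow> bool" where
  "closed_tuple a b c d e \<longleftrightarrow>
     pairing a a = 1 \<and> pairing b b = 1 \<and> pairing c c = 1 \<and> pairing d d = 1 \<and> pairing e e = 1 \<and>
     mirror a ** mirror b ** mirror c ** mirror d ** mirror e = - mat 1"

lemma matrix_mult_minus: "(A::real^3^3) ** (- B) = - (A ** B)" "(- A) ** (B::real^3^3) = - (A ** B)"
  by (simp_all add: matrix_matrix_mult_def vec_eq_iff sum_negf)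

lemma closed_tuple_rotate:
  assumes "closed_tuple a b c d e"
  shows "closed_tuple b c d e a"
proof -
  let ?M = "mirror b ** mirror c ** mirror d ** mirror e"
  have A: "mirror a ** mirror a = mat 1" using assms by (simp add: closed_tuple_def mirror_involution)
  have "mirror a ** ?M = - mat 1" using assms by (simp add: closed_tuple_def matrix_mul_assoc)
  then have "mirror a ** (mirror a ** ?M) = - mirror a" by (simp add: matrix_mult_minus)
  then have "?M = - mirror a" unfolding matrix_mul_assoc A by (simp add: matrix_mul_assoc)
  then have "?M ** mirror a = - mat 1" by (simp add: matrix_mult_minus A)
  then show ?thesis using assms by (simp add: closed_tuple_def)
qed

text \<open>
  The Hurwitz move.  It brings mirrors into neighbouring positions that were not neighbours
  before, and so lets identities for consecutive mirrors speak about others.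
\<close>

lemma closed_tuple_swap:
  assumes "closed_tuple a b c d e"
  shows "closed_tuple b (reflected b a) c d e"
proof -
  have "pairing a a = 1" "pairing b b = 1" using assms by (auto simp: closed_tuple_def)
  then have "mirror b ** mirror (reflected b a) = mirror a ** mirror b"
    by (simp add: mirror_reflected matrix_mul_assoc mirror_involution)
  then show ?thesis using assms by (simp add: closed_tuple_def pairing_reflected_self)
qed

text \<open>
  The two orientations of a closed walk give the same product of pairings.  Each flag enters
  both sides once through its covector and once through its vector, so the identities are
  unaffected by rescaling; they are the obstructions to making the matrix of pairings symmetric.
\<close>

definition same_triangle :: "flag \<Rightarrow> flag \<Rightarrow> flag \<Rightarrow> bool" where
  "same_triangle a b c \<longleftrightarrow>
     pairing a b * pairing b c * pairing c a = pairing a c * pairing c b * pairing b a"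

definition same_quad :: "flag \<Rightarrow> flag \<Rightarrow> flag \<Rightarrow> flag \<Rightarrow> bool" where
  "same_quad a b c d \<longleftrightarrow>
     pairing a b * pairing b c * pairing c d * pairing d a =
     pairing a d * pairing d c * pairing c b * pairing b a"

text \<open>
  The mirrors are involutions, so reversing a word in them inverts it.  The relation turns a
  word of length three into minus the complementary word of length two, and one of length four
  into minus a mirror; reversal preserves the traces of these shorter words.
\<close>

lemma trace_reversal:
  assumes "closed_tuple a b c d e"
  shows "trace (mirror a ** mirror b ** mirror c) = trace (mirror c ** mirror b ** mirror a)"
    "trace (mirror a ** mirror b ** mirror c ** mirror d)
     = trace (mirror d ** mirror c ** mirror b ** mirror a)"
proof -
  have I: "mirror a ** mirror a = mat 1" "mirror b ** mirror b = mat 1"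
      "mirror c ** mirror c = mat 1" "mirror d ** mirror d = mat 1" "mirror e ** mirror e = mat 1"
    using assms by (simp_all add: closed_tuple_def mirror_involution)
  have I': "X ** mirror a ** mirror a = X" "X ** mirror b ** mirror b = X"
      "X ** mirror c ** mirror c = X" "X ** mirror d ** mirror d = X" "X ** mirror e ** mirror e = X" for X
    using I by (simp_all flip: matrix_mul_assoc)
  have P: "mirror a ** mirror b ** mirror c ** mirror d ** mirror e = - mat 1"
    using assms by (simp add: closed_tuple_def)
  have P4: "mirror a ** mirror b ** mirror c ** mirror d = - mirror e"
    using arg_cong[OF P, of "\<lambda>X. X ** mirror e"] by (simp add: I' matrix_mult_minus)
  have P3: "mirror a ** mirror b ** mirror c = - (mirror e ** mirror d)"
    using arg_cong[OF P4, of "\<lambda>X. X ** mirror d"] by (simp add: I' matrix_mult_minus)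
  have "mat 1 = (mirror a ** mirror b ** mirror c ** mirror d)
      ** mirror d ** mirror c ** mirror b ** mirror a"
    by (simp only: I I')
  also have "\<dots> = - (mirror e ** mirror d ** mirror c ** mirror b ** mirror a)"
    unfolding P4 by (simp only: matrix_mult_minus)
  finally have Q: "mirror e ** mirror d ** mirror c ** mirror b ** mirror a = - mat 1" by simp
  have Q4: "mirror d ** mirror c ** mirror b ** mirror a = - mirror e"
    using arg_cong[OF Q, of "\<lambda>X. mirror e ** X"] by (simp add: I matrix_mult_minus matrix_mul_assoc)
  have Q3: "mirror c ** mirror b ** mirror a = - (mirror d ** mirror e)"
    using arg_cong[OF Q4, of "\<lambda>X. mirror d ** X"] by (simp add: I matrix_mult_minus matrix_mul_assoc)
  have N: "trace (- X) = - trace X" for X :: "real^3^3" by (simp add: trace_def sum_negf)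
  show "trace (mirror a ** mirror b ** mirror c) = trace (mirror c ** mirror b ** mirror a)"
    unfolding P3 Q3 N using trace_mul_sym[of "mirror e" "mirror d"] by simp
  show "trace (mirror a ** mirror b ** mirror c ** mirror d)
     = trace (mirror d ** mirror c ** mirror b ** mirror a)"
    unfolding P4 Q4 ..
qed

text \<open>
  In the traces of \<open>A B C\<close> and \<open>C B A\<close> the contributions of single mirrors and of pairs agree,
  and the difference is a multiple of the difference of the two orientations of the triangle.
\<close>

lemma closed_tuple_same_triangle:
  assumes "closed_tuple a b c d e"
  shows "same_triangle a b c"
proof -
  have u: "pairing a a = 1" "pairing b b = 1" "pairing c c = 1"
    using assms by (auto simp: closed_tuple_def)
  have "trace (mirror c ** mirror b ** mirror a) = trace (mirror b ** mirror a ** mirror c)"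
    using trace_mul_sym[of "mirror c" "mirror b ** mirror a"] by (simp add: matrix_mul_assoc)
  then have "fst c \<bullet> ((mirror a ** mirror b) *v snd c) = fst c \<bullet> ((mirror b ** mirror a) *v snd c)"
    using trace_reversal(1)[OF assms] trace_mul_sym[of "mirror a" "mirror b"]
    by (simp add: trace_mult_mirror u)
  then show ?thesis
    using u
    by (simp add: mirror_mult_vec same_triangle_def pairing_def inner_simps algebra_simps
        flip: matrix_vector_mul_assoc)
qed

text \<open>
  The Hurwitz move at \<open>c, d\<close> leaves the mirror \<open>d\<close> itself and makes it the successor of \<open>b\<close>.
\<close>

lemma closed_tuple_same_triangle':
  assumes "closed_tuple a b c d e"
  shows "same_triangle a b d"
proof -
  have "closed_tuple c d e a b" using closed_tuple_rotate[OF closed_tuple_rotate[OF assms]] .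
  then have d: "closed_tuple d (reflected d c) e a b" by (rule closed_tuple_swap)
  have "closed_tuple a b d (reflected d c) e"
    using closed_tuple_rotate[OF closed_tuple_rotate[OF closed_tuple_rotate[OF d]]] .
  then show ?thesis by (rule closed_tuple_same_triangle)
qed

lemma closed_tuple_four_triangles:
  assumes "closed_tuple a b c d e"
  shows "same_triangle a b c" "same_triangle b c d" "same_triangle a b d" "same_triangle c d a"
proof -
  have 1: "closed_tuple b c d e a" using assms by (rule closed_tuple_rotate)
  then have 2: "closed_tuple c d e a b" by (rule closed_tuple_rotate)
  show "same_triangle a b c" "same_triangle b c d" "same_triangle a b d" "same_triangle c d a"
    using closed_tuple_same_triangle[OF assms] closed_tuple_same_triangle[OF 1]
      closed_tuple_same_triangle'[OF assms] closed_tuple_same_triangle'[OF 2] by auto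
qed

text \<open>
  In the trace of \<open>A B C D\<close> only triangles and the quadrilateral are sensitive to reversal, and
  the triangles are already known to be symmetric.
\<close>

lemma closed_tuple_same_quad:
  assumes "closed_tuple a b c d e"
  shows "same_quad a b c d"
proof -
  have u: "pairing a a = 1" "pairing b b = 1" "pairing c c = 1" "pairing d d = 1"
    using assms by (auto simp: closed_tuple_def)
  note t = closed_tuple_four_triangles[OF assms]
  have "trace (mirror d ** mirror c ** mirror b ** mirror a)
      = trace (mirror c ** mirror b ** mirror a ** mirror d)"
    using trace_mul_sym[of "mirror d" "mirror c ** mirror b ** mirror a"] by (simp add: matrix_mul_assoc)
  then have "fst d \<bullet> ((mirror a ** mirror b ** mirror c) *v snd d)
      = fst d \<bullet> ((mirror c ** mirror b ** mirror a) *v snd d)"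
    using trace_reversal[OF assms]
    by (simp add: trace_mult_mirror u)
  then have "pairing d b * pairing b a * pairing a d + pairing d c * pairing c a * pairing a d
       + pairing d c * pairing c b * pairing b d
       - 2 * (pairing d c * pairing c b * pairing b a * pairing a d)
    = pairing d a * pairing a b * pairing b d + pairing d a * pairing a c * pairing c d
       + pairing d b * pairing b c * pairing c d
       - 2 * (pairing d a * pairing a b * pairing b c * pairing c d)"
    using u
    by (simp add: mirror_mult_vec pairing_def inner_simps algebra_simps
        flip: matrix_vector_mul_assoc)
  then show ?thesis using t unfolding same_quad_def same_triangle_def by algebra
qed

text \<open>
  The triangle identity for \<open>c\<close>, \<open>d\<close> and the image of \<open>a\<close> under the mirror in \<open>b\<close> is bilinear in
  the covector and the vector of that image.  Expanded, it consists of triangles, of a triangle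
  times \<open>pairing a b * pairing b a\<close>, and of the two quadrilaterals \<open>a b c d\<close> and \<open>b a c d\<close>, the
  first of which is known.
\<close>

lemma closed_tuple_same_quad':
  assumes "closed_tuple a b c d e"
  shows "same_quad b a c d"
proof -
  have u: "pairing a a = 1" "pairing b b = 1" "pairing c c = 1" "pairing d d = 1"
    using assms by (auto simp: closed_tuple_def)
  note t = closed_tuple_four_triangles[OF assms]
  have "closed_tuple b (reflected b a) c d e" using assms by (rule closed_tuple_swap)
  then have "same_triangle (reflected b a) c d"
    by (intro closed_tuple_same_triangle[OF closed_tuple_rotate])
  moreover have "same_quad a b c d" using assms by (rule closed_tuple_same_quad)
  ultimately show ?thesis using t u
    unfolding same_quad_def same_triangle_def pairing_reflected by algebra
qed

text \<open>
  The third cyclic order on four mirrors, obtained in the same way from the image of \<open>b\<close> under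
  the mirror in \<open>c\<close>.
\<close>

lemma closed_tuple_same_quad'':
  assumes "closed_tuple a b c d e"
  shows "same_quad a c b d"
proof -
  have u: "pairing a a = 1" "pairing b b = 1" "pairing c c = 1" "pairing d d = 1"
    using assms by (auto simp: closed_tuple_def)
  note t = closed_tuple_four_triangles[OF assms]
  have "closed_tuple b c d e a" using assms by (rule closed_tuple_rotate)
  then have "closed_tuple c (reflected c b) d e a" by (rule closed_tuple_swap)
  then have "closed_tuple (reflected c b) d e a c" by (rule closed_tuple_rotate)
  then have "same_triangle (reflected c b) d a" by (rule closed_tuple_same_triangle')
  moreover have "same_quad a b c d" using assms by (rule closed_tuple_same_quad)
  ultimately show ?thesis using t u
    unfolding same_quad_def same_triangle_def pairing_reflected by algebra
qed

lemma UNIV_5: "(UNIV :: 5 set) = {0, 1, 2, 3, 4}"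
  by (rule card_subset_eq[symmetric]) auto

lemma forall_5: "(\<forall>i::5. P i) \<longleftrightarrow> P 0 \<and> P 1 \<and> P 2 \<and> P 3 \<and> P 4"
proof -
  have "(\<forall>i::5. P i) \<longleftrightarrow> (\<forall>i\<in>{0, 1, 2, 3, 4}. P i)" unfolding UNIV_5[symmetric] by simp
  then show ?thesis by simp
qed

lemma same_triangle_perms:
  assumes "same_triangle a b c"
  shows "same_triangle a b c \<and> same_triangle b c a \<and> same_triangle c a b \<and>
    same_triangle c b a \<and> same_triangle b a c \<and> same_triangle a c b"
  using assms by (simp add: same_triangle_def mult_ac)

lemma same_quad_perms:
  assumes "same_quad a b c d"
  shows "same_quad a b c d \<and> same_quad b c d a \<and> same_quad c d a b \<and> same_quad d a b c \<and>
    same_quad d c b a \<and> same_quad c b a d \<and> same_quad b a d c \<and> same_quad a d c b"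
  using assms by (simp add: same_quad_def mult_ac)

text \<open>
  Up to rotation of the five mirrors, three of them are either consecutive or form the pattern
  \<open>a, b, d\<close>.
\<close>

lemma closed_all_triangles:
  fixes X :: "5 \<Rightarrow> flag"
  assumes "closed_tuple (X 4) (X 3) (X 2) (X 1) (X 0)"
  assumes "distinct [i, j, k]"
  shows "same_triangle (X i) (X j) (X k)"
proof -
  note r0 = assms(1)
  note r1 = closed_tuple_rotate[OF r0]
  note r2 = closed_tuple_rotate[OF r1]
  note r3 = closed_tuple_rotate[OF r2]
  note r4 = closed_tuple_rotate[OF r3]
  note t = r0[THEN closed_tuple_same_triangle] r1[THEN closed_tuple_same_triangle]
    r2[THEN closed_tuple_same_triangle] r3[THEN closed_tuple_same_triangle]
    r4[THEN closed_tuple_same_triangle] r0[THEN closed_tuple_same_triangle']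
    r1[THEN closed_tuple_same_triangle'] r2[THEN closed_tuple_same_triangle']
    r3[THEN closed_tuple_same_triangle'] r4[THEN closed_tuple_same_triangle']
  have "\<forall>i j k. distinct [i, j, k] \<longrightarrow> same_triangle (X i) (X j) (X k)"
    using t[THEN same_triangle_perms] by (simp add: forall_5)
  then show ?thesis using assms(2) by blast
qed

text \<open>
  Any four of the five mirrors are consecutive up to rotation, and four elements have three
  cyclic orders up to reversal.
\<close>

lemma closed_all_quads:
  fixes X :: "5 \<Rightarrow> flag"
  assumes "closed_tuple (X 4) (X 3) (X 2) (X 1) (X 0)"
  assumes "distinct [i, j, k, l]"
  shows "same_quad (X i) (X j) (X k) (X l)"
proof -
  note r0 = assms(1)
  note r1 = closed_tuple_rotate[OF r0]
  note r2 = closed_tuple_rotate[OF r1]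
  note r3 = closed_tuple_rotate[OF r2]
  note r4 = closed_tuple_rotate[OF r3]
  note r = r0 r1 r2 r3 r4
  note t = r[THEN closed_tuple_same_quad] r[THEN closed_tuple_same_quad']
    r[THEN closed_tuple_same_quad'']
  have "\<forall>i j k l. distinct [i, j, k, l] \<longrightarrow> same_quad (X i) (X j) (X k) (X l)"
    using t[THEN same_quad_perms] by (simp add: forall_5)
  then show ?thesis using assms(2) by blast
qed

section \<open>Symmetrizing a matrix of order five\<close>

lemma distinct5_UNIV:
  assumes "distinct [p, q, r, s, t :: 5]"
  shows "x = p \<or> x = q \<or> x = r \<or> x = s \<or> x = t"
proof -
  have "card {p, q, r, s, t} = card (UNIV :: 5 set)" using assms by simp
  then have "{p, q, r, s, t} = UNIV" by (intro card_subset_eq) auto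
  then show ?thesis by blast
qed

lemma obtain_other_three:
  assumes "v \<noteq> (w::5)"
  obtains x y z where "distinct [v, w, x, y, z]"
proof -
  have "card (UNIV - {v, w}) = 3" using assms by (simp add: card_Diff_subset)
  then obtain x y z where "UNIV - {v, w} = {x, y, z}" "x \<noteq> y" "y \<noteq> z" "x \<noteq> z"
    by (metis card_3_iff)
  then have "distinct [v, w, x, y, z]" using assms by auto
  then show ?thesis by (rule that)
qed

text \<open>
  A 2-regular simple graph on five vertices is a 5-cycle, because every component of it is a
  cycle and has at least three vertices.  The edges will be the zero entries of a matrix; the
  complement of a 5-cycle is again a 5-cycle.
\<close>

lemma two_regular_is_pentagon:
  fixes Z :: "5 \<Rightarrow> 5 \<Rightarrow> bool"
  assumes sym: "\<And>i j. Z i j \<Longrightarrow> Z j i"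
    and at_most: "\<And>x i j k. distinct [x, i, j, k] \<Longrightarrow> Z x i \<Longrightarrow> Z x j \<Longrightarrow> \<not> Z x k"
    and at_least: "\<And>v w. v \<noteq> w \<Longrightarrow> \<exists>j. j \<noteq> v \<and> j \<noteq> w \<and> Z v j"
  obtains p q r s t where "distinct [p, q, r, s, t]" "Z p q" "Z q r" "Z r s" "Z s t" "Z t p"
    "\<not> Z p r" "\<not> Z r t" "\<not> Z t q" "\<not> Z q s" "\<not> Z s p"
proof -
  define p :: 5 where "p = 0"
  have "p \<noteq> 1" by (simp add: p_def)
  then obtain q where q: "q \<noteq> p" "Z p q" using at_least by blast
  then obtain t where t: "t \<noteq> p" "t \<noteq> q" "Z p t" using at_least[of p q] by blast
  obtain r where r: "r \<noteq> q" "r \<noteq> p" "Z q r" using q at_least[of q p] by blast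
  have "r \<noteq> t"
  proof
    assume rt: "r = t"
    obtain x y where xy: "distinct [p, q, t, x, y]"
    proof -
      obtain x y z where d: "distinct [p, q, x, y, z]" using obtain_other_three[of p q] q by metis
      then have "t = x \<or> t = y \<or> t = z" using distinct5_UNIV[OF d, of t] t by auto
      then show ?thesis using d that[of y z] that[of x z] that[of x y] by auto
    qed
    obtain j where j: "j \<noteq> x" "j \<noteq> y" "Z x j" using at_least[of x y] xy by auto
    then have "j = p \<or> j = q \<or> j = t" using distinct5_UNIV[OF xy, of j] by auto
    then show False
      using j xy q t r rt sym at_most[of p q t x] at_most[of q p t x] at_most[of t p q x] by auto
  qed
  then obtain s where d: "distinct [p, q, r, s, t]"
  proof -
    obtain x y z where d: "distinct [p, q, x, y, z]" using obtain_other_three[of p q] q by metis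
    have "t = x \<or> t = y \<or> t = z" using distinct5_UNIV[OF d, of t] t by auto
    moreover have "r = x \<or> r = y \<or> r = z" using distinct5_UNIV[OF d, of r] r by auto
    ultimately show ?thesis using d \<open>r \<noteq> t\<close> that[of x] that[of y] that[of z] by auto
  qed
  note U = distinct5_UNIV[OF d]
  have pq: "Z q p" "Z t p" "Z r q" using q t r sym by auto
  have nqs: "\<not> Z q s" "\<not> Z q t" using at_most[of q p r] d pq r by auto
  have nps: "\<not> Z p s" "\<not> Z p r" using at_most[of p q t] d q t by auto
  have "\<not> Z t r"
  proof
    assume tr: "Z t r"
    obtain j where "j \<noteq> s" "j \<noteq> r" "Z s j" using at_least[of s r] d by auto
    then show False using U[of j] nqs nps sym at_most[of t p r s] d pq tr by auto
  qed
  moreover obtain j where "j \<noteq> t" "j \<noteq> p" "Z t j" using at_least[of t p] d by auto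
  ultimately have ts: "Z t s" using U[of j] nqs sym by auto
  obtain j' where "j' \<noteq> s" "j' \<noteq> t" "Z s j'" using at_least[of s t] d by auto
  then have sr: "Z s r" using U[of j'] nqs nps sym by auto
  show ?thesis
    using that[of p q r s t] d q r sr ts t pq nqs nps \<open>\<not> Z t r\<close> sym by blast
qed

text \<open>
  If some row \<open>v\<close> has at most one zero, say at \<open>w\<close>, the values of \<open>\<mu>\<close> propagate from \<open>v\<close> along
  edges, and reach \<open>w\<close> by a detour over one further vertex; consistency then only involves
  triangles and quadrilaterals.  Otherwise each row has exactly two zeros off the diagonal, the
  nonzero entries form a 5-cycle, and its identity is the only consistency condition.
\<close>

lemma exists_potential:
  fixes a :: "5 \<Rightarrow> 5 \<Rightarrow> real"
  assumes zero: "\<And>i j. a i j = 0 \<Longrightarrow> a j i = 0"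
    and few: "\<And>x i j k. distinct [x, i, j, k] \<Longrightarrow> a i x = 0 \<Longrightarrow> a j x = 0 \<Longrightarrow> a k x \<noteq> 0"
    and tri: "\<And>i j k. distinct [i, j, k] \<Longrightarrow> a i j * a j k * a k i = a i k * a k j * a j i"
    and quad: "\<And>i j k l. distinct [i, j, k, l] \<Longrightarrow>
      a i j * a j k * a k l * a l i = a i l * a l k * a k j * a j i"
    and pent: "\<And>p q r s t. distinct [p, q, r, s, t] \<Longrightarrow> a p r = 0 \<Longrightarrow> a p s = 0 \<Longrightarrow> a q s = 0 \<Longrightarrow>
      a q t = 0 \<Longrightarrow> a r t = 0 \<Longrightarrow>
      a p q * a q r * a r s * a s t * a t p = a p t * a t s * a s r * a r q * a q p"
  shows "\<exists>\<mu>. (\<forall>i. \<mu> i \<noteq> 0) \<and> (\<forall>i j. \<mu> i * a i j = \<mu> j * a j i)"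
proof (cases "\<exists>v w. v \<noteq> w \<and> (\<forall>j. j \<noteq> v \<longrightarrow> j \<noteq> w \<longrightarrow> a v j \<noteq> 0)")
  case True
  then obtain v w where vw: "v \<noteq> w" and nz: "\<And>j. j \<noteq> v \<Longrightarrow> j \<noteq> w \<Longrightarrow> a v j \<noteq> 0" by blast
  have nz': "a j v \<noteq> 0" if "j \<noteq> v" "j \<noteq> w" for j using nz[OF that] zero by blast
  obtain u where u: "u \<noteq> v" "u \<noteq> w" "a u w \<noteq> 0" "a w u \<noteq> 0"
  proof -
    obtain x y z where d: "distinct [v, w, x, y, z]" using obtain_other_three[OF vw] .
    have "a x w \<noteq> 0 \<or> a y w \<noteq> 0 \<or> a z w \<noteq> 0" using few[of w x y z] d by auto
    then show ?thesis using that[of x] that[of y] that[of z] d zero by auto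
  qed
  define \<mu> where "\<mu> j = (if j = v then 1 else if j = w then (a v u / a u v) * (a u w / a w u)
    else a v j / a j v)" for j
  have uv: "a v u \<noteq> 0" "a u v \<noteq> 0" using nz nz' u by auto
  \<comment> \<open>The entry \<open>a v w\<close> may vanish or not; if it does not, the edge from \<open>v\<close> to \<open>w\<close> closes a
    triangle over \<open>u\<close>.\<close>
  have mw: "\<mu> j * a j w = \<mu> w * a w j" for j
  proof -
    consider "j = w" | "j = v" | "j = u" | "distinct [v, u, w, j]" using u vw by auto
    then show ?thesis
    proof cases
      case 2
      then show ?thesis using tri[of v u w] u uv vw by (simp add: \<mu>_def field_simps)
    next
      case 3
      then show ?thesis using u uv vw by (simp add: \<mu>_def field_simps)
    next
      case 4
      then have "a j v \<noteq> 0" "j \<noteq> v" "j \<noteq> w" using nz' by auto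
      then show ?thesis using quad[OF 4] u uv vw by (simp add: \<mu>_def field_simps)
    qed simp
  qed
  have "\<mu> i * a i j = \<mu> j * a j i" for i j
  proof -
    consider "i = w" | "j = w" | "i = j" | "i = v" "j \<noteq> v" "j \<noteq> w" | "j = v" "i \<noteq> v" "i \<noteq> w"
      | "distinct [v, i, j]" "i \<noteq> w" "j \<noteq> w" by auto
    then show ?thesis
    proof cases
      case 1
      then show ?thesis using mw[of j] by simp
    next
      case 2
      then show ?thesis using mw[of i] by simp
    next
      case 6
      then have "a i v \<noteq> 0" "a j v \<noteq> 0" using nz' by auto
      then show ?thesis using tri[of v i j] 6 by (simp add: \<mu>_def field_simps)
    qed (use nz nz' vw in \<open>auto simp: \<mu>_def\<close>)
  qed
  moreover have "\<mu> i \<noteq> 0" for i using u uv nz[of i] nz'[of i] by (auto simp: \<mu>_def)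
  ultimately show ?thesis by blast
next
  case False
  \<comment> \<open>The zeros run along \<open>p s q t r\<close>, so the nonzero entries run along \<open>p q r s t\<close>.\<close>
  obtain p s q t r where d: "distinct [p, s, q, t, r]"
    and Z: "a p s = 0" "a s q = 0" "a q t = 0" "a t r = 0" "a r p = 0"
    and N: "a p q \<noteq> 0" "a q r \<noteq> 0" "a r s \<noteq> 0" "a s t \<noteq> 0" "a t p \<noteq> 0"
  proof (rule two_regular_is_pentagon[of "\<lambda>i j. a i j = 0"])
    show "a x k \<noteq> 0" if "distinct [x, i, j, k]" "a x i = 0" "a x j = 0" for x i j k
      using few[OF that(1)] that zero by blast
    show "\<exists>j. j \<noteq> v \<and> j \<noteq> w \<and> a v j = 0" if "v \<noteq> w" for v w
      using False that by blast
  qed (use zero in blast)+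
  have d': "distinct [p, q, r, s, t]" using d by auto
  have N': "a q p \<noteq> 0" "a r q \<noteq> 0" "a s r \<noteq> 0" "a t s \<noteq> 0" "a p t \<noteq> 0" using N zero by blast+
  have Z': "a s p = 0" "a q s = 0" "a t q = 0" "a r t = 0" "a p r = 0" using Z zero by blast+
  define \<mu> where "\<mu> j = (if j = p then 1 else if j = q then a p q / a q p
    else if j = r then a p q / a q p * (a q r / a r q)
    else if j = t then a p t / a t p else a p t / a t p * (a t s / a s t))" for j
  have P: "a p q * a q r * a r s * a s t * a t p = a p t * a t s * a s r * a r q * a q p"
    using pent[OF d'] Z Z' by simp
  have m: "\<mu> p = 1" "\<mu> q = a p q / a q p" "\<mu> r = a p q / a q p * (a q r / a r q)"
    "\<mu> t = a p t / a t p" "\<mu> s = a p t / a t p * (a t s / a s t)"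
    using d by (auto simp: \<mu>_def)
  have rs: "\<mu> r * a r s = \<mu> s * a s r" using P N N' by (simp add: m field_simps)
  have "\<mu> i * a i j = \<mu> j * a j i" for i j
    using distinct5_UNIV[OF d', of i] distinct5_UNIV[OF d', of j]
    by (elim disjE) (use N N' rs in \<open>simp_all add: m Z Z'\<close>)
  moreover have "\<mu> i \<noteq> 0" for i using distinct5_UNIV[OF d', of i] N N' by (auto simp: m)
  ultimately show ?thesis by blast
qed

text \<open>
  Four vectors in \<open>\<real>\<^sup>3\<close> are linearly dependent.  Here the zero pattern determines the dependence
  among \<open>v q\<close>, \<open>v r\<close>, \<open>v s\<close>, \<open>v t\<close> explicitly, and pairing it with \<open>l p\<close> gives the relation.
\<close>

lemma pentagon_relation:
  fixes l v :: "5 \<Rightarrow> real^3"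
  assumes unit: "\<And>i. l i \<bullet> v i = 1"
    and zeros: "l p \<bullet> v r = 0" "l p \<bullet> v s = 0" "l q \<bullet> v s = 0" "l q \<bullet> v t = 0" "l r \<bullet> v t = 0"
      "l t \<bullet> v q = 0" "l t \<bullet> v r = 0"
    and ker: "\<And>w. l q \<bullet> w = 0 \<Longrightarrow> l r \<bullet> w = 0 \<Longrightarrow> l t \<bullet> w = 0 \<Longrightarrow> w = 0"
  shows "(l p \<bullet> v q) * (l q \<bullet> v r) * (l r \<bullet> v s) =
    (l p \<bullet> v t) * (l t \<bullet> v s) * (1 - (l q \<bullet> v r) * (l r \<bullet> v q))"
proof -
  let ?c = "1 - (l q \<bullet> v r) * (l r \<bullet> v q)"
  \<comment> \<open>Starting from the coefficient of \<open>v r\<close>, the others are forced by annihilation under \<open>l q\<close>,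
    \<open>l r\<close> and \<open>l t\<close>.\<close>
  define w where "w = - ((l q \<bullet> v r) * (l r \<bullet> v s)) *\<^sub>R v q + (l r \<bullet> v s) *\<^sub>R v r - ?c *\<^sub>R v s
    + ((l t \<bullet> v s) * ?c) *\<^sub>R v t"
  have "w = 0"
    by (rule ker) (simp_all add: w_def inner_simps unit zeros, simp_all add: algebra_simps)
  then have "l p \<bullet> w = 0" by simp
  then have "- ((l q \<bullet> v r) * (l r \<bullet> v s)) * (l p \<bullet> v q) + (l t \<bullet> v s) * ?c * (l p \<bullet> v t) = 0"
    by (simp only: w_def inner_simps zeros)
  then show ?thesis by algebra
qed

text \<open>
  Two distinct points lie on only one line: the common kernel of two independent covectors is
  spanned by their cross product.
\<close>

lemma common_kernel_imp_cross_eq_0: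
  fixes l m u v :: "real^3"
  assumes "l \<bullet> u = 0" "l \<bullet> v = 0" "m \<bullet> u = 0" "m \<bullet> v = 0"
    and "u \<noteq> 0" "v \<noteq> 0" "\<not> same_proj_point u v"
  shows "cross3 l m = 0"
proof (rule ccontr)
  define n where "n = cross3 l m"
  assume "cross3 l m \<noteq> 0"
  then have n: "n \<noteq> 0" by (simp add: n_def)
  have 1: "cross3 n x = 0" if "l \<bullet> x = 0" "m \<bullet> x = 0" for x
    using that Lagrange[of x l m] cross_skew[of n x] by (simp add: n_def inner_commute)
  obtain \<alpha> where \<alpha>: "u = \<alpha> *\<^sub>R n"
    using 1[of u] assms n by (auto simp: cross_eq_0 collinear_lemma)
  obtain \<beta> where \<beta>: "v = \<beta> *\<^sub>R n"
    using 1[of v] assms n by (auto simp: cross_eq_0 collinear_lemma)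
  have "\<alpha> \<noteq> 0" "\<beta> \<noteq> 0" using assms \<alpha> \<beta> by auto
  then have "u = (\<alpha> / \<beta>) *\<^sub>R v" "\<alpha> / \<beta> \<noteq> 0" by (auto simp: \<alpha> \<beta>)
  then show False using assms by (auto simp: same_proj_point_def)
qed

section \<open>Five mirrors in general position\<close>

lemma invertible_if_trivial_kernel:
  fixes A :: "real^3^3"
  assumes "\<And>w. A *v w = 0 \<Longrightarrow> w = 0"
  shows "invertible A"
  using assms matrix_left_invertible_ker[of A] invertible_left_inverse[of A] by blast

lemma inner_transpose_mult:
  fixes M :: "real^3^3"
  shows "x \<bullet> (transpose M *v y) = (M *v x) \<bullet> y"
  by (metis dot_lmul_matrix inner_commute transpose_matrix_vector)

text \<open>
  Concurrency and collinearity are expressed by trivial kernels, so that common points at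
  infinity count as well.
\<close>

locale closed_billiard =
  fixes X :: "5 \<Rightarrow> flag"
  assumes closed: "closed_tuple (X 4) (X 3) (X 2) (X 1) (X 0)"
    and no_three_concurrent: "\<And>i j k w. distinct [i, j, k] \<Longrightarrow>
      fst (X i) \<bullet> w = 0 \<Longrightarrow> fst (X j) \<bullet> w = 0 \<Longrightarrow> fst (X k) \<bullet> w = 0 \<Longrightarrow> w = 0"
    and distinct_points: "\<And>i j. i \<noteq> j \<Longrightarrow> \<not> same_proj_point (snd (X i)) (snd (X j))"
    and no_four_on_line: "\<And>i j k l m. distinct [i, j, k, l] \<Longrightarrow>
      m \<bullet> snd (X i) = 0 \<Longrightarrow> m \<bullet> snd (X j) = 0 \<Longrightarrow> m \<bullet> snd (X k) = 0 \<Longrightarrow> m \<bullet> snd (X l) = 0 \<Longrightarrow> m = 0"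
begin

text \<open>
  The entry \<open>a i j\<close> vanishes exactly if centre \<open>j\<close> lies on axis \<open>i\<close>.
\<close>

definition a :: "5 \<Rightarrow> 5 \<Rightarrow> real" where
  "a i j = pairing (X i) (X j)"

lemma unit: "a i i = 1"
proof -
  have "\<forall>i. a i i = 1" using closed unfolding forall_5 by (simp add: closed_tuple_def a_def)
  then show ?thesis by blast
qed

lemma triangle: "distinct [i, j, k] \<Longrightarrow> a i j * a j k * a k i = a i k * a k j * a j i"
  using closed_all_triangles[OF closed, of i j k] by (simp add: same_triangle_def a_def)

lemma quad:
  "distinct [i, j, k, l] \<Longrightarrow> a i j * a j k * a k l * a l i = a i l * a l k * a k j * a j i"
  using closed_all_quads[OF closed, of i j k l] by (simp add: same_quad_def a_def)

lemma nonzero: "fst (X i) \<noteq> 0" "snd (X i) \<noteq> 0"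
  using unit[of i] by (auto simp: a_def pairing_def)

lemma few_axes_through_centre:
  assumes "distinct [i, j, k]" "a i x = 0" "a j x = 0"
  shows "a k x \<noteq> 0"
  using no_three_concurrent[of i j k "snd (X x)"] assms nonzero(2)[of x]
  by (auto simp: a_def pairing_def)

text \<open>
  Suppose that centre \<open>v\<close> lies on axis \<open>u\<close>, but not centre \<open>u\<close> on axis \<open>v\<close>.  The triangle
  identities force every further index \<open>k\<close> to satisfy \<open>a u k = 0\<close> or \<open>a k v = 0\<close>.  The first
  cannot hold for all three, since four centres would lie on axis \<open>u\<close>; the second holds at most
  once, since three axes would pass through centre \<open>v\<close>.  Thus there are \<open>k\<close> and \<open>i\<close> with
  \<open>a k v = 0\<close>, \<open>a u k \<noteq> 0\<close>, \<open>a u i = 0\<close>, \<open>a i v \<noteq> 0\<close>, and the quadrilateral \<open>u k i v\<close> has a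
  nonzero product in one direction only.
\<close>

lemma zero_symmetric:
  assumes "a u v = 0"
  shows "a v u = 0"
proof (rule ccontr)
  assume vu: "a v u \<noteq> 0"
  have uv: "u \<noteq> v" using assms unit[of u] by auto
  have 1: "a u k * a k v = 0" if "distinct [u, v, k]" for k
    using triangle[OF that] assms vu by auto
  obtain x y z where d: "distinct [u, v, x, y, z]" using obtain_other_three[OF uv] .
  have "\<not> (a u x = 0 \<and> a u y = 0 \<and> a u z = 0)"
    using no_four_on_line[of v x y z "fst (X u)"] d assms nonzero(1)[of u]
    by (auto simp: a_def pairing_def)
  then obtain k i where ki: "distinct [u, v, k, i]" and uk: "a u k \<noteq> 0"
    using d that[of x y] that[of y x] that[of z x] by auto
  have kv: "a k v = 0" using 1[of k] ki uk by auto
  have iv: "a i v \<noteq> 0" using few_axes_through_centre[of u k i v] assms kv ki by auto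
  have ui: "a u i = 0" using 1[of i] ki iv by auto
  \<comment> \<open>Otherwise axes \<open>u\<close> and \<open>k\<close> would share the two distinct centres \<open>v\<close> and \<open>i\<close>; the
    combination of these centres on axis \<open>i\<close> would then lie on three axes.\<close>
  have "a k i \<noteq> 0"
  proof
    assume "a k i = 0"
    then have "a i v *\<^sub>R snd (X i) - snd (X v) = 0"
      using ki assms kv ui unit[of i]
      by (intro no_three_concurrent[of u k i]) (auto simp: a_def pairing_def inner_simps)
    then have "snd (X v) = a i v *\<^sub>R snd (X i)" by simp
    then show False using distinct_points[of v i] ki iv by (auto simp: same_proj_point_def)
  qed
  then show False using quad[of u k i v] ki assms uk iv vu by auto
qed

text \<open>
  Nonzero entries of \<open>a\<close> are left only on the diagonal and along the cycle \<open>p q r s t\<close>.  The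
  identity is the combination of \<open>pentagon_relation\<close> with its dual, in which the roles of axes
  and centres are exchanged.
\<close>

lemma five_cycle:
  assumes d: "distinct [p, q, r, s, t]"
    and Z: "a p r = 0" "a p s = 0" "a q s = 0" "a q t = 0" "a r t = 0"
  shows "a p q * a q r * a r s * a s t * a t p = a p t * a t s * a s r * a r q * a q p"
proof -
  define l where "l i = fst (X i)" for i
  define v where "v i = snd (X i)" for i
  have A: "l i \<bullet> v j = a i j" "v i \<bullet> l j = a j i" for i j
    by (simp_all add: l_def v_def a_def pairing_def inner_commute)
  have Z': "a r p = 0" "a s p = 0" "a s q = 0" "a t q = 0" "a t r = 0"
    using Z zero_symmetric by auto
  have 1: "a p q * a q r * a r s = a p t * a t s * (1 - a q r * a r q)"
    unfolding A[symmetric]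
  proof (rule pentagon_relation)
    show "w = 0" if "l q \<bullet> w = 0" "l r \<bullet> w = 0" "l t \<bullet> w = 0" for w
      using no_three_concurrent[of q r t w] d that by (simp add: l_def)
  qed (simp_all add: A Z Z' unit)
  have "(v p \<bullet> l q) * (v q \<bullet> l r) * (v r \<bullet> l s) =
    (v p \<bullet> l t) * (v t \<bullet> l s) * (1 - (v q \<bullet> l r) * (v r \<bullet> l q))"
  proof (rule pentagon_relation)
    \<comment> \<open>Centres \<open>q\<close> and \<open>r\<close> both lie on axis \<open>t\<close>, so the line through them is that axis, and
      centre \<open>t\<close> is not on it.\<close>
    fix m assume m: "v q \<bullet> m = 0" "v r \<bullet> m = 0" "v t \<bullet> m = 0"
    have "\<not> same_proj_point (v q) (v r)" using distinct_points[of q r] d by (simp add: v_def)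
    then have "cross3 (l t) m = 0"
      using common_kernel_imp_cross_eq_0[of "l t" "v q" "v r" m] m nonzero
      by (simp add: A Z' inner_commute[of m]) (simp add: v_def)
    then obtain c where c: "m = c *\<^sub>R l t \<or> m = 0"
      using nonzero(1)[of t] by (auto simp: cross_eq_0 collinear_lemma l_def)
    then show "m = 0" using m(3) by (auto simp: A unit)
  qed (simp_all add: A Z Z' unit)
  then have 2: "a q p * a r q * a s r = a t p * a s t * (1 - a q r * a r q)"
    unfolding A by (simp add: mult_ac)
  show ?thesis using 1 2 by algebra
qed

lemma exists_balancing:
  "\<exists>\<mu>. (\<forall>i. \<mu> i \<noteq> 0) \<and> (\<forall>i j. \<mu> i * a i j = \<mu> j * a j i)"
proof (rule exists_potential)
  show "a k x \<noteq> 0" if "distinct [x, i, j, k]" "a i x = 0" "a j x = 0" for x i j k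
    using few_axes_through_centre[of i j k x] that by simp
qed (fact zero_symmetric triangle quad five_cycle)+

text \<open>
  The inverse \<open>R\<close> of \<open>Q\<close> is easier to construct, because three axes always form a basis of the
  dual space, whereas three centres may be collinear: prescribe \<open>R l = v / \<mu>\<close> on the first three
  axes.  The balance condition makes \<open>R\<close> symmetric and extends the prescription to the other two
  axes, and \<open>R\<close> is injective because the centres span.
\<close>

lemma exists_invariant_form:
  "\<exists>Q. nondegenerate_symmetric Q \<and> (\<exists>\<mu>. \<forall>k. Q *v snd (X k) = \<mu> k *\<^sub>R fst (X k))"
proof -
  obtain \<mu> where nz: "\<And>i. \<mu> i \<noteq> 0" and bal: "\<And>i j. \<mu> i * a i j = \<mu> j * a j i"
    using exists_balancing by blast
  \<comment> \<open>The rows of a matrix of type \<^typ>\<open>real^3^3\<close> are indexed by the type \<^typ>\<open>3\<close>, in which \<open>3 = 0\<close>.\<close>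
  define ix :: "3 \<Rightarrow> 5" where "ix i = (if i = 1 then 0 else if i = 2 then 1 else 2)" for i
  have detect: "w = 0" if "\<And>i. fst (X (ix i)) \<bullet> w = 0" for w
    using no_three_concurrent[of 0 1 2 w] that[of 1] that[of 2] that[of 3] by (simp add: ix_def)
  define A :: "real^3^3" where "A = (\<chi> i. fst (X (ix i)))"
  define B :: "real^3^3" where "B = (\<chi> i. (1 / \<mu> (ix i)) *\<^sub>R snd (X (ix i)))"
  have rows: "(M *v w) $ i = M $ i \<bullet> w" for M :: "real^3^3" and w i
    by (simp add: matrix_vector_mult_def inner_vec_def)
  have invA: "invertible A"
  proof (rule invertible_if_trivial_kernel)
    fix w assume "A *v w = 0"
    then have "fst (X (ix i)) \<bullet> w = 0" for i using rows[of A w i] by (simp add: A_def)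
    then show "w = 0" by (rule detect)
  qed
  from invA obtain A' where "A ** A' = mat 1" by (auto simp: invertible_def)
  define R where "R = A' ** B"
  have "A ** R = B" using \<open>A ** A' = mat 1\<close> by (simp add: R_def matrix_mul_assoc)
  then have lR: "fst (X (ix i)) \<bullet> (R *v x) = (snd (X (ix i)) \<bullet> x) / \<mu> (ix i)" for i x
    using rows[of A "R *v x" i] rows[of B x i] by (simp add: matrix_vector_mul_assoc A_def B_def)
  have Rl: "R *v fst (X k) = (1 / \<mu> k) *\<^sub>R snd (X k)" for k
  proof -
    have "R *v fst (X k) - (1 / \<mu> k) *\<^sub>R snd (X k) = 0"
    proof (rule detect)
      fix i
      show "fst (X (ix i)) \<bullet> (R *v fst (X k) - (1 / \<mu> k) *\<^sub>R snd (X k)) = 0"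
        using bal[of "ix i" k] nz
        by (simp add: inner_simps lR a_def pairing_def inner_commute field_simps)
    qed
    then show ?thesis by simp
  qed
  have "transpose R *v x - R *v x = 0" for x
    by (rule detect) (simp add: inner_simps inner_transpose_mult lR Rl del: transpose_matrix_vector)
  then have symR: "transpose R = R" by (simp add: matrix_eq)
  have invR: "invertible R"
  proof (rule invertible_if_trivial_kernel)
    fix x assume x: "R *v x = 0"
    have "x \<bullet> snd (X k) = 0" for k
    proof -
      have "x \<bullet> (R *v fst (X k)) = 0"
        using inner_transpose_mult[of x R "fst (X k)"] x by (simp add: symR)
      then show ?thesis using nz by (simp add: Rl)
    qed
    then show "x = 0" using no_four_on_line[of 0 1 2 3 x] by simp
  qed
  from invR obtain Q where QR: "Q ** R = mat 1" and RQ: "R ** Q = mat 1"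
    by (auto simp: invertible_def)
  have "transpose Q ** R = mat 1"
    using arg_cong[OF RQ, of transpose] by (simp add: matrix_transpose_mul symR transpose_mat)
  then have "transpose Q = Q" by (metis RQ matrix_mul_assoc matrix_mul_lid matrix_mul_rid)
  moreover have "det Q \<noteq> 0" using QR invertible_det_nz[of Q] RQ by (auto simp: invertible_def)
  moreover have "Q *v snd (X k) = \<mu> k *\<^sub>R fst (X k)" for k
  proof -
    have "snd (X k) = \<mu> k *\<^sub>R (R *v fst (X k))" using nz by (simp add: Rl)
    then have "Q *v snd (X k) = \<mu> k *\<^sub>R ((Q ** R) *v fst (X k))"
      by (simp add: matrix_vector_mult_scaleR matrix_vector_mul_assoc)
    then show ?thesis by (simp add: QR)
  qed
  ultimately show ?thesis unfolding nondegenerate_symmetric_def by blast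
qed

end

text \<open>
  For \<open>\<mu> \<noteq> 0\<close> the mirror is the reflection \<open>x \<mapsto> x - 2 (x\<^sup>T Q v / v\<^sup>T Q v) v\<close> of the form in the
  centre \<open>v\<close>; for \<open>\<mu> = 0\<close> it changes vectors only by elements of the radical of \<open>Q\<close>.
\<close>

lemma mirror_preserves_form:
  assumes unit: "pairing p p = 1" and sym: "transpose Q = Q"
    and pol: "Q *v snd p = \<mu> *\<^sub>R fst p"
  shows "transpose (mirror p) ** Q ** mirror p = Q" "mirror p \<in> orthogonal_group_of Q"
proof -
  have pol': "snd p \<bullet> (Q *v y) = \<mu> * (fst p \<bullet> y)" for y
    using inner_transpose_mult[of "snd p" Q y] by (simp add: sym pol)
  have *: "(mirror p *v x) \<bullet> (Q *v (mirror p *v y)) = x \<bullet> (Q *v y)" for x y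
    using unit by (simp add: mirror_mult_vec pol pol' matrix_vector_mult_diff_distrib
        matrix_vector_mult_scaleR inner_simps pairing_def inner_commute algebra_simps)
  have "x \<bullet> ((transpose (mirror p) ** Q ** mirror p) *v y) = x \<bullet> (Q *v y)" for x y
    using *[of x y] by (simp add: inner_transpose_mult del: transpose_matrix_vector
        flip: matrix_vector_mul_assoc)
  then have "(transpose (mirror p) ** Q ** mirror p) *v y = Q *v y" for y
    by (metis vector_eq_ldot)
  then show "transpose (mirror p) ** Q ** mirror p = Q" by (simp add: matrix_eq)
  have "invertible (mirror p)" using mirror_involution[OF unit] by (auto simp: invertible_def)
  then show "mirror p \<in> orthogonal_group_of Q" using * by (simp add: orthogonal_group_of_def)
qed

section \<open>Sides of a convex pentagon\<close>

text \<open>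
  A face of a convex set is the intersection of the set with the affine hull of the face, so a
  vertex on the supporting line of a side lies on the side itself; being extreme, it is an
  endpoint.
\<close>

lemma vertex_on_side_line:
  assumes "convex_pentagon P" "P j \<in> side_line P i"
  shows "j = i \<or> j = i + 1"
proof (rule ccontr)
  assume j: "\<not> (j = i \<or> j = i + 1)"
  let ?S = "convex hull (range P)"
  have inj: "inj P" and ext: "P j extreme_point_of ?S"
    and edge: "closed_segment (P i) (P (i + 1)) face_of ?S"
    using assms(1) by (auto simp: convex_pentagon_def edge_of_def)
  have "P j \<in> affine hull closed_segment (P i) (P (i + 1)) \<inter> ?S"
    using assms(2) hull_inc[of "P j" "range P" convex]
    by (simp add: side_line_def segment_convex_hull affine_hull_convex_hull)
  then have "P j \<in> closed_segment (P i) (P (i + 1))"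
    using face_of_imp_eq_affine_Int[OF _ edge] by (auto simp: convex_convex_hull)
  moreover have "P j \<noteq> P i" "P j \<noteq> P (i + 1)" using j inj by (auto dest: injD)
  ultimately have "P j \<in> open_segment (P i) (P (i + 1))" by (simp add: open_segment_def)
  moreover have "P i \<in> ?S" "P (i + 1) \<in> ?S" by (auto intro: hull_inc)
  ultimately show False using ext by (auto simp: extreme_point_of_def)
qed

lemma triangular_pairing_imp_independent:
  fixes l1 l2 l3 c1 c2 c3 w :: "real^3"
  assumes "l1 \<bullet> c1 \<noteq> 0" "l2 \<bullet> c1 = 0" "l1 \<bullet> c2 = 0" "l2 \<bullet> c2 \<noteq> 0"
    and "l1 \<bullet> c3 = 0" "l2 \<bullet> c3 = 0" "l3 \<bullet> c3 \<noteq> 0"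
    and "l1 \<bullet> w = 0" "l2 \<bullet> w = 0" "l3 \<bullet> w = 0"
  shows "w = 0"
proof -
  define A :: "real^3^3" where "A = vector [l1, l2, l3]"
  define C :: "real^3^3" where "C = transpose (vector [c1, c2, c3])"
  have AC: "(A ** C) $ i $ j = A $ i \<bullet> (transpose C) $ j" for i j
    by (simp add: matrix_matrix_mult_def inner_vec_def transpose_def)
  have "det (A ** C) \<noteq> 0" using assms by (simp add: det_3 AC) (simp add: A_def C_def)
  then have "invertible A" by (simp add: det_mul invertible_det_nz)
  moreover have "A *v w = 0"
    using assms by (simp add: vec_eq_iff forall_3 A_def matrix_vector_mult_def sum_3 inner_vec_def)
  ultimately show ?thesis by (metis invertible_def matrix_left_invertible_ker)
qed

text \<open>
  Among three of five cyclically ordered sides two are adjacent.  Their only common point is a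
  vertex of the pentagon, and the third line avoids it.
\<close>

lemma pentagon_sides_not_concurrent:
  assumes pent: "convex_pentagon P"
    and sides: "\<And>i. affine_part (l i) = side_line P i"
    and d: "distinct [i, j, k]"
    and w: "l i \<bullet> w = 0" "l j \<bullet> w = 0" "l k \<bullet> w = 0"
  shows "w = 0"
proof -
  have on: "l m \<bullet> affine_chart (P n) = 0 \<longleftrightarrow> n = m \<or> n = m + 1" for m n
  proof -
    have "l m \<bullet> affine_chart (P n) = 0 \<longleftrightarrow> P n \<in> side_line P m"
      by (simp flip: sides add: affine_part_def)
    moreover have "P m \<in> side_line P m" "P (m + 1) \<in> side_line P m"
      by (auto simp: side_line_def intro: hull_inc)
    ultimately show ?thesis using vertex_on_side_line[OF pent] by blast
  qed
  have adjacent: "w = 0"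
    if "l m \<bullet> w = 0" "l (m + 1) \<bullet> w = 0" "l n \<bullet> w = 0" "n \<noteq> m" "n \<noteq> m + 1" for m n
  proof -
    have ne: "m + 2 \<noteq> m" "m + 2 \<noteq> m + 1" "m \<noteq> m + 1" "m \<noteq> m + 2" "m + 1 + 1 = m + 2"
      by (simp_all add: add.assoc)
    have m: "m + 1 = n + 1 \<longleftrightarrow> m = n" by simp
    \<comment> \<open>Evaluated at the vertices \<open>m + 2\<close>, \<open>m\<close>, \<open>m + 1\<close>, the three covectors form a triangular
      matrix.\<close>
    show ?thesis
    proof (rule triangular_pairing_imp_independent)
      show "l m \<bullet> affine_chart (P (m + 2)) \<noteq> 0" "l (m + 1) \<bullet> affine_chart (P (m + 2)) = 0"
        "l m \<bullet> affine_chart (P m) = 0" "l (m + 1) \<bullet> affine_chart (P m) \<noteq> 0"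
        "l m \<bullet> affine_chart (P (m + 1)) = 0" "l (m + 1) \<bullet> affine_chart (P (m + 1)) = 0"
        "l n \<bullet> affine_chart (P (m + 1)) \<noteq> 0"
        unfolding on ne(5) m using ne that(4,5) by metis+
    qed (use that in auto)
  qed
  have "\<forall>i j k::5. distinct [i, j, k] \<longrightarrow>
      j = i + 1 \<or> k = i + 1 \<or> i = j + 1 \<or> k = j + 1 \<or> i = k + 1 \<or> j = k + 1"
    by (simp add: forall_5)
  then have "j = i + 1 \<or> k = i + 1 \<or> i = j + 1 \<or> k = j + 1 \<or> i = k + 1 \<or> j = k + 1"
    using d by blast
  then show ?thesis
    using adjacent[of i k] adjacent[of i j] adjacent[of j k] adjacent[of j i]
      adjacent[of k j] adjacent[of k i] w d by auto
qed

section \<open>The invariant conic\<close>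

theorem theorem5p17:
  fixes H :: "5 \<Rightarrow> real^3^3"
    and axis centre :: "5 \<Rightarrow> real^3"
    and P :: "5 \<Rightarrow> real^2"
    and \<sigma> :: "5 \<Rightarrow> 5"
  assumes homology: "\<And>i. is_harmonic_homology (H i) (axis i) (centre i)"
    and product: "H 4 ** H 3 ** H 2 ** H 1 ** H 0 = - mat 1"
    and pentagon: "convex_pentagon P"
    and labelling: "bij \<sigma>"
    and sides: "\<And>i. affine_part (axis (\<sigma> i)) = side_line P i"
    and distinct_centres: "\<And>i j. i \<noteq> j \<Longrightarrow> \<not> same_proj_point (centre i) (centre j)"
    and no_four_collinear: "\<And>S. card S = 4 \<Longrightarrow> \<not> proj_collinear (centre ` S)"
  shows "(\<exists>Q. nondegenerate_symmetric Q \<and> (\<forall>i. transpose (H i) ** Q ** H i = Q))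
         \<and> cayley_klein_constant_curvature H"
proof -
  define X where "X i = ((1 / (axis i \<bullet> centre i)) *\<^sub>R axis i, centre i)" for i
  have ne: "axis i \<bullet> centre i \<noteq> 0" and Hi: "H i = harmonic_homology (axis i) (centre i)" for i
    using homology[of i] by (auto simp: is_harmonic_homology_def)
  have norm: "pairing (X i) (X i) = 1" for i using ne by (simp add: X_def pairing_def)
  have HX: "H i = mirror (X i)" for i
    using ne[of i] by (simp add: matrix_eq mirror_mult_vec[OF norm] Hi harmonic_homology_mult_vec)
      (simp add: X_def)
  interpret closed_billiard X
  proof
    show "closed_tuple (X 4) (X 3) (X 2) (X 1) (X 0)"
      using product by (simp add: closed_tuple_def norm HX)
  next
    fix i j k w
    assume d: "distinct [i, j, k]"
      and w: "fst (X i) \<bullet> w = 0" "fst (X j) \<bullet> w = 0" "fst (X k) \<bullet> w = 0"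
    obtain i' j' k' where ijk: "i = \<sigma> i'" "j = \<sigma> j'" "k = \<sigma> k'"
      using labelling by (metis bij_pointE)
    show "w = 0"
      by (rule pentagon_sides_not_concurrent[OF pentagon, of "axis \<circ> \<sigma>" i' j' k'])
        (use d w ne in \<open>auto simp: sides ijk X_def\<close>)
  next
    show "\<not> same_proj_point (snd (X i)) (snd (X j))" if "i \<noteq> j" for i j
      using distinct_centres[OF that] by (simp add: X_def)
  next
    fix i j k l m
    assume "distinct [i, j, k, l]" "m \<bullet> snd (X i) = 0" "m \<bullet> snd (X j) = 0" "m \<bullet> snd (X k) = 0"
      "m \<bullet> snd (X l) = 0"
    then show "m = 0"
      using no_four_collinear[of "{i, j, k, l}"] by (auto simp: proj_collinear_def X_def)
  qed
  obtain Q \<mu> where Q: "nondegenerate_symmetric Q" "\<And>k. Q *v snd (X k) = \<mu> k *\<^sub>R fst (X k)"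
    using exists_invariant_form by blast
  have "transpose Q = Q" using Q(1) by (simp add: nondegenerate_symmetric_def)
  then have "transpose (H i) ** Q ** H i = Q" "H i \<in> orthogonal_group_of Q" for i
    using mirror_preserves_form[OF norm _ Q(2)] by (simp_all add: HX)
  then show ?thesis using Q(1) unfolding cayley_klein_constant_curvature_def by blast
qed

end
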